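(* Let $n$ be an odd positive integer. Then $$259\,\tau(n)=\tfrac{1}{2^3\cdot3^2}\left[17\cdot691\,\sigma_3(n)+8\cdot691\,\sigma_5(n)+2\cdot691\,\sigma_7(n)-9\,\sigma_{11}(n)\right]-\tfrac{691\cdot2^2}{3^2}\sum_{m=1}^{n-1}\left[\sigma_3^{\dagger}(m)\sigma_7^{\dagger}(n-m)-\sigma_5^{\dagger}(m)\sigma_5^{\dagger}(n-m)\right].$$
   Context: Ramanujan's tau function $\tau(n)$ is defined by $q\prod_{r\ge1}(1-q^r)^{24}=\sum_{n=1}^{\infty}\tau(n)q^n$. For positive integers $r,n$, $\sigma_r(n):=\sum_{d\mid n,\,d>0}d^r$ and $\sigma_r^{\dagger}(n):=\sum_{d\mid n,\,d>0}(-1)^{d}d^r$. *)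

theory Defs
  imports "HOL-Analysis.Analysis" "HOL-Computational_Algebra.Formal_Power_Series"
begin

text \<open>The product is indexed from 0, and the infinite product is taken in the
  \<open>X\<close>-adic topology on formal power series.\<close>

definition ramanujan_tau :: "nat \<Rightarrow> int" where
  "ramanujan_tau n =
     fps_nth (fps_X * (\<Prod>r. (1 - fps_X ^ Suc r) ^ 24)) n"

definition divisor_sigma :: "nat \<Rightarrow> nat \<Rightarrow> nat" where
  "divisor_sigma r n = (\<Sum>d | d dvd n. d ^ r)"

definition divisor_sigma_dagger :: "nat \<Rightarrow> nat \<Rightarrow> int" where
  "divisor_sigma_dagger r n = (\<Sum>d | d dvd n. (-1) ^ d * int d ^ r)"

text \<open>The product does converge, so the coefficients above are the intended ones.\<close>

lemma has_prod_eta24: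
  "(\<lambda>r. (1 - fps_X ^ Suc r) ^ 24 :: int fps) has_prod
     Abs_fps (\<lambda>k. fps_nth (\<Prod>r\<le>k. (1 - fps_X ^ Suc r) ^ 24) k)"
proof -
  define f :: "nat \<Rightarrow> int fps" where "f = (\<lambda>r. (1 - fps_X ^ Suc r) ^ 24)"
  define L where "L = Abs_fps (\<lambda>k. fps_nth (\<Prod>r\<le>k. f r) k)"
  have step: "fps_nth (P * f r) k = fps_nth P k" if "k \<le> r" for P r k
  proof -
    have "fps_nth (P * (1 - fps_X ^ Suc r) ^ m) k = fps_nth P k" for m
    proof (induction m)
      case (Suc m)
      have "P * (1 - fps_X ^ Suc r) ^ Suc m =
          P * (1 - fps_X ^ Suc r) ^ m - fps_X ^ Suc r * (P * (1 - fps_X ^ Suc r) ^ m)"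
        by (simp add: algebra_simps)
      then have "fps_nth (P * (1 - fps_X ^ Suc r) ^ Suc m) k =
          fps_nth (P * (1 - fps_X ^ Suc r) ^ m) k -
          fps_nth (fps_X ^ Suc r * (P * (1 - fps_X ^ Suc r) ^ m)) k"
        by (simp only: fps_sub_nth)
      also have "fps_nth (fps_X ^ Suc r * (P * (1 - fps_X ^ Suc r) ^ m)) k = 0"
        using that by (simp only: fps_X_power_mult_nth) simp
      finally show ?case using Suc.IH by simp
    qed simp
    then show ?thesis by (simp add: f_def)
  qed
  have stable: "fps_nth (\<Prod>r\<le>n. f r) k = fps_nth L k" if "k \<le> n" for n k
    using that
  proof (induction n rule: dec_induct)
    case base
    show ?case by (simp add: L_def)
  next
    case (step n)
    have "fps_nth (\<Prod>r\<le>Suc n. f r) k = fps_nth (\<Prod>r\<le>n. f r) k"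
      using \<open>k \<le> n\<close> by (simp add: \<open>\<And>P r k. k \<le> r \<Longrightarrow> fps_nth (P * f r) k = fps_nth P k\<close>)
    then show ?case using step by simp
  qed
  have "(\<lambda>n. \<Prod>r\<le>n. f r) \<longlonglongrightarrow> L"
    by (rule tendsto_fpsI) (auto intro!: stable eventually_sequentiallyI)
  moreover have "fps_nth L 0 = 1"
    by (simp add: L_def f_def fps_nth_power_0)
  then have "L \<noteq> 0" by auto
  ultimately have "f has_prod L"
    unfolding has_prod_def raw_has_prod_def by simp
  then show ?thesis by (simp add: L_def f_def)
qed

end

theory Submission
  imports Defs
begin

text \<open>
  Put \<open>S\<^sub>r = \<Sum> \<sigma>\<^sub>r\<^sup>\<dagger>(n) q\<^sup>n\<close> and \<open>D = q d/dq\<close>. Liouville's elementary identity on the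
  representations \<open>a x + b y = n\<close>, applied to \<open>F(k) = \<epsilon>\<^sup>k k\<^bsup>2j\<^esup>\<close> with \<open>\<epsilon> = 1\<close> or
  \<open>\<epsilon> = -1\<close>, gives Ramanujan's differential equations for the Eisenstein series \<open>E\<^sub>2, E\<^sub>4\<close> of
  level 1 and their analogues for \<open>P = 1 - 8 S\<^sub>1\<close> and \<open>Q = 1 + 16 S\<^sub>3\<close>. Comparing both systems, with
  \<open>e = 2 E\<^sub>2(q\<^sup>2) - E\<^sub>2(q)\<close>, yields \<open>1 - 8 S\<^sub>5 = e Q\<close>, \<open>2 D e = e P - Q\<close> and
  \<open>D Q = Q (P - e)\<close>, and then the chain of convolution identities expresses \<open>S\<^sub>7, S\<^sub>9, S\<^sub>1\<^sub>1\<close> as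
  polynomials in \<open>e\<close> and \<open>Q\<close>. In the combination \<open>S\<^sub>3 S\<^sub>7 - S\<^sub>5\<^sup>2\<close> the term \<open>e\<^sup>2 Q\<^sup>2\<close> cancels,
  so its only nonlinear part is \<open>9 Q\<^sup>3 / 512\<close>. Finally
  \<open>691 Q\<^sup>3 = 691 + 16 S\<^sub>1\<^sub>1 - 518 Q\<^sup>2 (e\<^sup>2 - Q) - 16 Q (e\<^sup>2 - Q)\<^sup>2\<close>, where logarithmic
  derivatives identify \<open>Q\<^sup>2 (e\<^sup>2 - Q)\<close> with \<open>64 \<Sum> \<tau>(n) q\<^sup>n\<close> and show that
  \<open>Q (e\<^sup>2 - Q)\<^sup>2\<close> is a series in \<open>q\<^sup>2\<close>, which does not contribute to odd coefficients.
\<close>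

section \<open>Liouville's identity\<close>

text \<open>The constant coefficient is 0, being a sum over the infinite set of divisors of 0.\<close>

definition divisor_series :: "(nat \<Rightarrow> real) \<Rightarrow> real fps" where
  "divisor_series c = Abs_fps (\<lambda>n. \<Sum>d | d dvd n. c d)"

definition bilinear_reps :: "nat \<Rightarrow> (nat \<times> nat \<times> nat \<times> nat) set" where
  "bilinear_reps n = {(a, b, x, y). 0 < a \<and> 0 < b \<and> 0 < x \<and> 0 < y \<and> a * x + b * y = n}"

lemma finite_bilinear_reps [simp]: "finite (bilinear_reps n)"
proof -
  have "bilinear_reps n \<subseteq> {..n} \<times> {..n} \<times> {..n} \<times> {..n}"
  proof (clarsimp simp: bilinear_reps_def)
    fix a b x y :: nat
    assume "0 < a" "0 < b" "0 < x" "0 < y"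
    moreover have "a \<le> a * x" "x \<le> a * x" "b \<le> b * y" "y \<le> b * y"
      using calculation by simp_all
    ultimately show "a \<le> a * x + b * y \<and> b \<le> a * x + b * y \<and> x \<le> a * x + b * y \<and> y \<le> a * x + b * y"
      by linarith
  qed
  then show ?thesis
    by (rule finite_subset) auto
qed

lemma bilinear_reps_0 [simp]: "bilinear_reps 0 = {}"
  by (auto simp: bilinear_reps_def)

text \<open>Each pair of divisors \<open>a\<close> of \<open>i\<close> and \<open>b\<close> of
  \<open>n - i\<close> is recorded together with its cofactors \<open>x\<close> and
  \<open>y\<close>.\<close>

lemma divisor_series_mult_nth:
  "fps_nth (divisor_series c * divisor_series c') n =
     (\<Sum>(a, b, x, y)\<in>bilinear_reps n. c a * c' b)"
proof -
  let ?D = "\<lambda>i. {d::nat. d dvd i}"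
  have "fps_nth (divisor_series c * divisor_series c') n =
      (\<Sum>i=0..n. (\<Sum>a\<in>?D i. c a) * (\<Sum>b\<in>?D (n - i). c' b))"
    by (simp add: fps_mult_nth divisor_series_def)
  \<comment> \<open>The end terms vanish: the divisors of 0 form an infinite set, over which
    \<open>sum\<close> is 0.\<close>
  also have "\<dots> = (\<Sum>i\<in>{0<..<n}. (\<Sum>a\<in>?D i. c a) * (\<Sum>b\<in>?D (n - i). c' b))"
    by (rule sum.mono_neutral_right) (auto simp: infinite_UNIV_nat)
  also have "\<dots> = (\<Sum>i\<in>{0<..<n}. \<Sum>(a, b)\<in>?D i \<times> ?D (n - i). c a * c' b)"
    by (simp add: sum_product sum.cartesian_product)
  also have "\<dots> = (\<Sum>(i, a, b)\<in>(SIGMA i:{0<..<n}. ?D i \<times> ?D (n - i)). c a * c' b)"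
    by (subst sum.Sigma) (auto intro: finite_divisors_nat)
  also have "\<dots> = (\<Sum>(a, b, x, y)\<in>bilinear_reps n. c a * c' b)"
    by (rule sum.reindex_bij_witness[of _ "\<lambda>(a, b, x, y). (a * x, a, b)"
          "\<lambda>(i, a, b). (a, b, i div a, (n - i) div b)"])
       (auto simp: bilinear_reps_def div_greater_zero_iff dvd_imp_le dvd_div_eq_0_iff
           intro!: Nat.gr0I)
  finally show ?thesis .
qed

text \<open>The substitution rests on \<open>a x + b y = (a - b) x + b (x + y)\<close>.\<close>

lemma sum_bilinear_reps_diff:
  "(\<Sum>(a, b, x, y) | (a, b, x, y) \<in> bilinear_reps n \<and> b < a. f (a - b)) =
   (\<Sum>(a, b, x, y) | (a, b, x, y) \<in> bilinear_reps n \<and> x < y. f a)"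
  by (rule sum.reindex_bij_witness[of _ "\<lambda>(a, b, x, y). (a + b, b, x, y - x)"
        "\<lambda>(a, b, x, y). (a - b, b, x, x + y)"])
     (auto simp: bilinear_reps_def algebra_simps elim!: less_natE)

text \<open>The substitution rests on \<open>a x + b y = (a + b) y + a (x - y)\<close>.\<close>

lemma sum_bilinear_reps_add:
  "(\<Sum>(a, b, x, y) | (a, b, x, y) \<in> bilinear_reps n \<and> y < x. f (a + b)) =
   (\<Sum>(a, b, x, y) | (a, b, x, y) \<in> bilinear_reps n \<and> b < a. f a)"
  by (rule sum.reindex_bij_witness[of _ "\<lambda>(a, b, x, y). (b, a - b, x + y, x)"
        "\<lambda>(a, b, x, y). (a + b, a, y, x - y)"])
     (auto simp: bilinear_reps_def algebra_simps elim!: less_natE)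

text \<open>For fixed \<open>a\<close> and \<open>y\<close>, the shifts \<open>(b, x) \<mapsto> (b + a, x - y)\<close> preserve \<open>a x + b y\<close>; each
  orbit contains exactly one element with \<open>b \<le> a\<close> and exactly one with \<open>x \<le> y\<close>.\<close>

lemma sum_bilinear_reps_euclid:
  "(\<Sum>(a, b, x, y) | (a, b, x, y) \<in> bilinear_reps n \<and> b \<le> a. f a) =
   (\<Sum>(a, b, x, y) | (a, b, x, y) \<in> bilinear_reps n \<and> x \<le> y. f a)"
proof -
  have fwd: "a * (x - y * ((x - 1) div y)) + (b + a * ((x - 1) div y)) * y = a * x + b * y"
    "0 < x - y * ((x - 1) div y)" "x - y * ((x - 1) div y) \<le> y"
    if "0 < x" "0 < y" for a b x y :: nat
  proof -
    \<comment> \<open>Dividing \<open>x - 1\<close> instead of \<open>x\<close> gives remainders in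
      \<open>1..y\<close> rather than \<open>0..y - 1\<close>, as positivity of the new
      \<open>x\<close> requires.\<close>
    define t r where "t = (x - 1) div y" and "r = (x - 1) mod y"
    have x: "x = y * t + r + 1"
      using that mult_div_mod_eq[of y "x - 1"] unfolding t_def r_def by linarith
    have "r < y"
      using that by (simp add: r_def)
    then show "0 < x - y * ((x - 1) div y)" "x - y * ((x - 1) div y) \<le> y"
      unfolding t_def[symmetric] by (simp_all add: x)
    show "a * (x - y * ((x - 1) div y)) + (b + a * ((x - 1) div y)) * y = a * x + b * y"
      unfolding t_def[symmetric] by (simp add: x algebra_simps)
  qed
  have fwd': "a * (x + y * ((b - 1) div a)) + (b - a * ((b - 1) div a)) * y = a * x + b * y"
    if "0 < b" "0 < a" for a b x y :: nat
    using fwd(1)[of b a y x] that by (simp add: ac_simps)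
  have inv: "(b + a * t - 1) div a = t" if "0 < b" "b \<le> a" for a b t :: nat
  proof -
    have "b + a * t - 1 = (b - 1) + a * t" using that by simp
    moreover have "(b - 1 + a * t) div a = t"
      using that by (subst div_mult_self2) simp_all
    ultimately show ?thesis by (simp only:)
  qed
  have sub: "x - y * ((x - 1) div y) + y * ((x - 1) div y) = x" if "0 < x" for x y :: nat
    using that mult_div_mod_eq[of y "x - 1"] by linarith
  have lt: "y * ((x - 1) div y) < x" if "0 < x" for x y :: nat
    using that mult_div_mod_eq[of y "x - 1"] by linarith
  show ?thesis
    by (rule sum.reindex_bij_witness[of _
          "\<lambda>(a, b, x, y). (a, b - a * ((b - 1) div a), x + y * ((b - 1) div a), y)"
          "\<lambda>(a, b, x, y). (a, b + a * ((x - 1) div y), x - y * ((x - 1) div y), y)"])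
       (auto simp: bilinear_reps_def fwd fwd' inv sub lt simp del: One_nat_def)
qed

text \<open>If \<open>a = b = d\<close> then \<open>d (x + y) = n\<close>, so \<open>d\<close> is a
  divisor and \<open>x = k\<close> is free below \<open>n div d\<close>.\<close>

lemma sum_bilinear_reps_left_diagonal:
  assumes "n > 0"
  shows "(\<Sum>(a, b, x, y) | (a, b, x, y) \<in> bilinear_reps n \<and> a = b. f a) =
    (\<Sum>d | d dvd n. \<Sum>k\<in>{1..<n div d}. f d)"
proof -
  have "(\<Sum>(a, b, x, y) | (a, b, x, y) \<in> bilinear_reps n \<and> a = b. f a) =
      (\<Sum>(d, k)\<in>(SIGMA d:{d. d dvd n}. {1..<n div d}). f d)"
    by (rule sum.reindex_bij_witness[of _ "\<lambda>(d, k). (d, d, k, n div d - k)"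
          "\<lambda>(a, b, x, y). (a, x)"])
       (use assms in \<open>auto simp: bilinear_reps_def div_mult_self1 simp flip: distrib_left
           intro!: Nat.gr0I\<close>)
  then show ?thesis
    using assms by (simp add: sum.Sigma finite_divisors_nat)
qed

text \<open>If \<open>x = y\<close> then \<open>d = a + b\<close> is a divisor of \<open>n\<close>
  with cofactor \<open>x\<close>, and \<open>a = k\<close> is free below \<open>d\<close>.\<close>

lemma sum_bilinear_reps_right_diagonal:
  assumes "n > 0"
  shows "(\<Sum>(a, b, x, y) | (a, b, x, y) \<in> bilinear_reps n \<and> x = y. f a (a + b)) =
    (\<Sum>d | d dvd n. \<Sum>k\<in>{1..<d}. f k d)"
proof -
  have "(\<Sum>(a, b, x, y) | (a, b, x, y) \<in> bilinear_reps n \<and> x = y. f a (a + b)) =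
      (\<Sum>(d, k)\<in>(SIGMA d:{d. d dvd n}. {1..<d}). f k d)"
    by (rule sum.reindex_bij_witness[of _ "\<lambda>(d, k). (k, d - k, n div d, n div d)"
          "\<lambda>(a, b, x, y). (a + b, a)"])
       (use assms in \<open>auto simp: bilinear_reps_def div_greater_zero_iff dvd_imp_le simp
           flip: distrib_right intro!: Nat.gr0I\<close>)
  then show ?thesis
    using assms by (simp add: sum.Sigma finite_divisors_nat)
qed

text \<open>With \<open>g\<close> a projection, the same trichotomy compares either \<open>a\<close>
  with \<open>b\<close> or \<open>x\<close> with \<open>y\<close>.\<close>

lemma sum_bilinear_reps_split:
  "(\<Sum>(a, b, x, y)\<in>bilinear_reps n. f a b x y) =
     (\<Sum>(a, b, x, y) | (a, b, x, y) \<in> bilinear_reps n \<and> g b y < (g a x :: nat). f a b x y) +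
     (\<Sum>(a, b, x, y) | (a, b, x, y) \<in> bilinear_reps n \<and> g a x < g b y. f a b x y) +
     (\<Sum>(a, b, x, y) | (a, b, x, y) \<in> bilinear_reps n \<and> g a x = g b y. f a b x y :: real)"
  (is "?S = sum _ ?A + sum _ ?B + sum _ ?C")
proof -
  let ?f = "\<lambda>(a, b, x, y). f a b x y"
  have fin: "finite ?A" "finite ?B" "finite ?C"
    by (auto intro!: finite_subset[OF _ finite_bilinear_reps[of n]])
  have "bilinear_reps n = (?A \<union> ?B) \<union> ?C"
    by auto
  then have "?S = sum ?f ((?A \<union> ?B) \<union> ?C)"
    by simp
  also have "\<dots> = sum ?f (?A \<union> ?B) + sum ?f ?C"
    by (rule sum.union_disjoint) (use fin in auto)
  also have "sum ?f (?A \<union> ?B) = sum ?f ?A + sum ?f ?B"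
    by (rule sum.union_disjoint) (use fin in auto)
  finally show ?thesis .
qed

lemma sum_bilinear_reps_le_split:
  "(\<Sum>(a, b, x, y) | (a, b, x, y) \<in> bilinear_reps n \<and> g a b x y \<le> (h a b x y :: nat). f a b x y) =
     (\<Sum>(a, b, x, y) | (a, b, x, y) \<in> bilinear_reps n \<and> g a b x y < h a b x y. f a b x y) +
     (\<Sum>(a, b, x, y) | (a, b, x, y) \<in> bilinear_reps n \<and> g a b x y = h a b x y. f a b x y :: real)"
  (is "sum _ ?S = sum _ ?A + sum _ ?B")
proof -
  let ?f = "\<lambda>(a, b, x, y). f a b x y"
  have fin: "finite ?A" "finite ?B"
    by (auto intro!: finite_subset[OF _ finite_bilinear_reps[of n]])
  have "?S = ?A \<union> ?B"
    by auto
  then have "sum ?f ?S = sum ?f (?A \<union> ?B)"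
    by simp
  also have "\<dots> = sum ?f ?A + sum ?f ?B"
    by (rule sum.union_disjoint) (use fin in auto)
  finally show ?thesis .
qed

lemma sum_bilinear_reps_swap_Collect:
  "(\<Sum>(a, b, x, y) | (a, b, x, y) \<in> bilinear_reps n \<and> P b a y x. f b a y x) =
   (\<Sum>(a, b, x, y) | (a, b, x, y) \<in> bilinear_reps n \<and> P a b x y. f a b x y)"
  by (rule sum.reindex_bij_witness[of _ "\<lambda>(a, b, x, y). (b, a, y, x)"
        "\<lambda>(a, b, x, y). (b, a, y, x)"])
     (auto simp: bilinear_reps_def add.commute)

lemma sum_divisors_complementary:
  assumes "n > (0::nat)"
  shows "(\<Sum>d | d dvd n. f (n div d)) = (\<Sum>d | d dvd n. f d)"
  by (rule sum.reindex_bij_witness[of _ "\<lambda>d. n div d" "\<lambda>d. n div d"])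
     (use assms in \<open>auto simp: div_div_eq_right\<close>)

text \<open>With truncated subtraction, \<open>a - b + (b - a)\<close> is the distance \<open>\<bar>a - b\<bar>\<close>.\<close>

lemma liouville_identity:
  fixes F :: "nat \<Rightarrow> real"
  assumes "n > 0"
  shows "(\<Sum>(a, b, x, y)\<in>bilinear_reps n. F (a - b + (b - a)) - F (a + b)) =
    (\<Sum>d | d dvd n. 2 * real (n div d) * F d + real d * F 0 - real d * F d - F 0 - F d
      - 2 * (\<Sum>k\<in>{1..<d}. F k))"
proof -
  let ?R = "bilinear_reps n"
  define N1 where "N1 = (\<Sum>(a, b, x, y) | (a, b, x, y) \<in> ?R \<and> b < a. F a)"
  define N2 where "N2 = (\<Sum>(a, b, x, y) | (a, b, x, y) \<in> ?R \<and> x < y. F a)"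
  define Z where "Z = (\<Sum>d | d dvd n. (real d - 1) * F 0)"
  define W where "W = (\<Sum>d | d dvd n. (real d - 1) * F d)"
  define U where "U = (\<Sum>d | d dvd n. (real (n div d) - 1) * F d)"
  define V where "V = (\<Sum>d | d dvd n. \<Sum>k\<in>{1..<d}. F k)"
  have pos: "0 < d" "0 < n div d" if "d dvd n" for d
    using that assms by (auto simp: div_greater_zero_iff dvd_imp_le intro!: Nat.gr0I)

  have "(\<Sum>(a, b, x, y) | (a, b, x, y) \<in> ?R \<and> b < a. F (a - b + (b - a))) =
      (\<Sum>(a, b, x, y) | (a, b, x, y) \<in> ?R \<and> b < a. F (a - b))"
    by (rule sum.cong) auto
  then have d1: "(\<Sum>(a, b, x, y) | (a, b, x, y) \<in> ?R \<and> b < a. F (a - b + (b - a))) = N2"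
    by (simp add: N2_def sum_bilinear_reps_diff)
  have d2: "(\<Sum>(a, b, x, y) | (a, b, x, y) \<in> ?R \<and> a < b. F (a - b + (b - a))) = N2"
    using sum_bilinear_reps_swap_Collect[of "\<lambda>a b x y. F (a - b + (b - a))" n "\<lambda>a b x y. b < a"] d1
    by (simp add: add.commute)
  have "(\<Sum>(a, b, x, y) | (a, b, x, y) \<in> ?R \<and> a = b. F (a - b + (b - a))) =
      (\<Sum>(a, b, x, y) | (a, b, x, y) \<in> ?R \<and> a = b. (\<lambda>_. F 0) a)"
    by (rule sum.cong) auto
  also have "\<dots> = (\<Sum>d | d dvd n. (real (n div d) - 1) * F 0)"
    unfolding sum_bilinear_reps_left_diagonal[OF assms]
    by (rule sum.cong) (use pos in \<open>auto simp: Suc_leI of_nat_diff\<close>)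
  also have "\<dots> = Z"
    unfolding Z_def by (rule sum_divisors_complementary[OF assms])
  finally have d3: "(\<Sum>(a, b, x, y) | (a, b, x, y) \<in> ?R \<and> a = b. F (a - b + (b - a))) = Z" .
  have diff: "(\<Sum>(a, b, x, y)\<in>?R. F (a - b + (b - a))) = 2 * N2 + Z"
    using sum_bilinear_reps_split[of "\<lambda>a b x y. F (a - b + (b - a))" n "\<lambda>a x. a"] d1 d2 d3 by simp

  have s1: "(\<Sum>(a, b, x, y) | (a, b, x, y) \<in> ?R \<and> y < x. F (a + b)) = N1"
    unfolding N1_def by (rule sum_bilinear_reps_add)
  have s2: "(\<Sum>(a, b, x, y) | (a, b, x, y) \<in> ?R \<and> x < y. F (a + b)) = N1"
    using sum_bilinear_reps_swap_Collect[of "\<lambda>a b x y. F (a + b)" n "\<lambda>a b x y. y < x"] s1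
    by (simp add: add.commute)
  have s3: "(\<Sum>(a, b, x, y) | (a, b, x, y) \<in> ?R \<and> x = y. F (a + b)) = W"
    unfolding W_def sum_bilinear_reps_right_diagonal[OF assms, of "\<lambda>k d. F d"]
    by (rule sum.cong) (use pos in \<open>auto simp: Suc_leI of_nat_diff\<close>)
  have add: "(\<Sum>(a, b, x, y)\<in>?R. F (a + b)) = 2 * N1 + W"
    using sum_bilinear_reps_split[of "\<lambda>a b x y. F (a + b)" n "\<lambda>a x. x"] s1 s2 s3 by simp

  have "(\<Sum>(a, b, x, y) | (a, b, x, y) \<in> ?R \<and> a = b. F a) = U"
    unfolding U_def sum_bilinear_reps_left_diagonal[OF assms]
    by (rule sum.cong) (use pos in \<open>auto simp: Suc_leI of_nat_diff\<close>)
  moreover have "(\<Sum>(a, b, x, y) | (a, b, x, y) \<in> ?R \<and> b = a. F a) =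
      (\<Sum>(a, b, x, y) | (a, b, x, y) \<in> ?R \<and> a = b. F a)"
    by (rule sum.cong) auto
  moreover have "(\<Sum>(a, b, x, y) | (a, b, x, y) \<in> ?R \<and> x = y. F a) = V"
    unfolding V_def by (rule sum_bilinear_reps_right_diagonal[OF assms])
  \<comment> \<open>Peeling the diagonals off both sides of the Euclidean identity turns the
    off-diagonal difference \<open>N2 - N1\<close> into the pure divisor sum
    \<open>U - V\<close>.\<close>
  ultimately have "N1 + U = N2 + V"
    using sum_bilinear_reps_euclid[of F n]
      sum_bilinear_reps_le_split[of "\<lambda>a b x y. F a" n "\<lambda>a b x y. b" "\<lambda>a b x y. a"]
      sum_bilinear_reps_le_split[of "\<lambda>a b x y. F a" n "\<lambda>a b x y. x" "\<lambda>a b x y. y"]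
    unfolding N1_def N2_def by simp
  then have "(\<Sum>(a, b, x, y)\<in>?R. F (a - b + (b - a)) - F (a + b)) = 2 * U - 2 * V + Z - W"
    using diff add by (simp add: case_prod_unfold sum_subtractf)
  also have "\<dots> = (\<Sum>d | d dvd n. 2 * ((real (n div d) - 1) * F d) - 2 * (\<Sum>k\<in>{1..<d}. F k)
      + (real d - 1) * F 0 - (real d - 1) * F d)"
    unfolding U_def V_def Z_def W_def by (simp add: sum.distrib sum_subtractf sum_distrib_left)
  also have "\<dots> = (\<Sum>d | d dvd n. 2 * real (n div d) * F d + real d * F 0 - real d * F d - F 0 - F d
      - 2 * (\<Sum>k\<in>{1..<d}. F k))"
    by (rule sum.cong) (auto simp: algebra_simps)
  finally show ?thesis .
qed

section \<open>Convolutions of divisor sums\<close>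

lemma sum_atMost_double_split:
  fixes j :: nat
  shows "(\<Sum>k\<le>2 * j. g k) = (\<Sum>i\<le>j. g (2 * i)) + (\<Sum>i<j. g (2 * i + 1) :: 'a :: comm_monoid_add)"
  by (induction j) (simp_all add: ac_simps)

text \<open>In the two expansions the terms of even index cancel and those of odd index
  double.\<close>

lemma binomial_odd_part:
  fixes a b :: "'a :: comm_ring_1"
  shows "(a + b) ^ (2 * j) - (a - b) ^ (2 * j) =
    2 * (\<Sum>i<j. of_nat (2 * j choose (2 * i + 1)) * a ^ (2 * i + 1) * b ^ (2 * j - 2 * i - 1))"
proof -
  have "(a - b) ^ (2 * j) = (a + - b) ^ (2 * j)"
    by simp
  also have "\<dots> = (\<Sum>i\<le>j. of_nat (2 * j choose (2 * i)) * a ^ (2 * i) * (- b) ^ (2 * j - 2 * i)) +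
      (\<Sum>i<j. of_nat (2 * j choose (2 * i + 1)) * a ^ (2 * i + 1) * (- b) ^ (2 * j - (2 * i + 1)))"
    unfolding binomial_ring[of a "- b"] by (rule sum_atMost_double_split)
  also have "(\<Sum>i\<le>j. of_nat (2 * j choose (2 * i)) * a ^ (2 * i) * (- b) ^ (2 * j - 2 * i)) =
      (\<Sum>i\<le>j. of_nat (2 * j choose (2 * i)) * a ^ (2 * i) * b ^ (2 * j - 2 * i))"
    by (rule sum.cong) simp_all
  also have "(\<Sum>i<j. of_nat (2 * j choose (2 * i + 1)) * a ^ (2 * i + 1) * (- b) ^
        (2 * j - (2 * i + 1))) =
      - (\<Sum>i<j. of_nat (2 * j choose (2 * i + 1)) * a ^ (2 * i + 1) * b ^ (2 * j - 2 * i - 1))"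
    unfolding sum_negf[symmetric]
  proof (rule sum.cong)
    fix i assume "i \<in> {..<j}"
    then have "odd (2 * j - (2 * i + 1))"
      by simp
    then show "of_nat (2 * j choose (2 * i + 1)) * a ^ (2 * i + 1) * (- b) ^ (2 * j - (2 * i + 1)) =
        - (of_nat (2 * j choose (2 * i + 1)) * a ^ (2 * i + 1) * b ^ (2 * j - 2 * i - 1))"
      by (simp add: power_minus_odd)
  qed simp
  finally have "(a - b) ^ (2 * j) =
      (\<Sum>i\<le>j. of_nat (2 * j choose (2 * i)) * a ^ (2 * i) * b ^ (2 * j - 2 * i)) -
      (\<Sum>i<j. of_nat (2 * j choose (2 * i + 1)) * a ^ (2 * i + 1) * b ^ (2 * j - 2 * i - 1))"
    by simp
  moreover have "(a + b) ^ (2 * j) =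
      (\<Sum>i\<le>j. of_nat (2 * j choose (2 * i)) * a ^ (2 * i) * b ^ (2 * j - 2 * i)) +
      (\<Sum>i<j. of_nat (2 * j choose (2 * i + 1)) * a ^ (2 * i + 1) * b ^ (2 * j - 2 * i - 1))"
    unfolding binomial_ring[of a b] sum_atMost_double_split by simp
  ultimately show ?thesis
    by simp
qed

definition qderiv :: "real fps \<Rightarrow> real fps" where
  "qderiv f = fps_X * fps_deriv f"

lemma qderiv_nth [simp]: "fps_nth (qderiv f) n = real n * fps_nth f n"
  by (cases n) (simp_all add: qderiv_def)

lemma qderiv_simps [simp]:
  "qderiv (f + g) = qderiv f + qderiv g" "qderiv (f - g) = qderiv f - qderiv g"
  "qderiv (- f) = - qderiv f" "qderiv (f * g) = qderiv f * g + f * qderiv g"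
  "qderiv (numeral k) = 0" "qderiv 1 = 0" "qderiv 0 = 0"
  by (simp_all add: qderiv_def algebra_simps flip: numeral_fps_const)

text \<open>The sign \<epsilon> = 1 or \<epsilon> = -1 covers both kinds of divisor sums, so
  Liouville's identity is expanded only once.\<close>

definition twisted_sigma_series :: "real \<Rightarrow> nat \<Rightarrow> real fps" where
  "twisted_sigma_series \<epsilon> r = divisor_series (\<lambda>d. \<epsilon> ^ d * real d ^ r)"

text \<open>Liouville's identity for \<open>F k = \<epsilon>^k k^(2j)\<close>: the difference of
  \<open>F\<close> at \<open>\<bar>a - b\<bar>\<close> and \<open>a + b\<close> splits binomially
  into products of odd powers of \<open>a\<close> and \<open>b\<close>, each product giving one
  convolution.\<close>

lemma twisted_sigma_convolution:
  assumes eps: "\<epsilon> ^ 2 = 1" and "j > 0"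
  shows "2 * (\<Sum>i<j. of_nat (2 * j choose (2 * i + 1)) *
      (twisted_sigma_series \<epsilon> (2 * i + 1) * twisted_sigma_series \<epsilon> (2 * j - 2 * i - 1))) =
    twisted_sigma_series \<epsilon> (2 * j + 1) - 2 * qderiv (twisted_sigma_series \<epsilon> (2 * j - 1)) +
    divisor_series (\<lambda>d. \<epsilon> ^ d * real d ^ (2 * j) + 2 * (\<Sum>k<d. \<epsilon> ^ k * real k ^ (2 * j)))"
    (is "?L = ?R")
proof (rule fps_ext)
  fix n
  let ?B = "\<lambda>i. real (2 * j choose (2 * i + 1))"
  define F where "F = (\<lambda>k. \<epsilon> ^ k * real k ^ (2 * j))"
  have F0: "F 0 = 0"
    using \<open>j > 0\<close> by (simp add: F_def)
  have F: "F (a - b + (b - a)) - F (a + b) =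
      - (2 * (\<Sum>i<j. ?B i * (\<epsilon> ^ a * real a ^ (2 * i + 1) * (\<epsilon> ^ b * real b ^
          (2 * j - 2 * i - 1)))))" for a b
  proof -
    \<comment> \<open>The numbers \<open>\<bar>a - b\<bar>\<close> and \<open>a + b\<close> differ
      by \<open>2 m\<close>, so both carry the same sign.\<close>
    define m where "m = min a b"
    have "a + b = (a - b + (b - a)) + 2 * m"
      by (simp add: m_def min_def)
    then have "\<epsilon> ^ (a + b) = \<epsilon> ^ (a - b + (b - a)) * (\<epsilon> ^ 2) ^ m"
      by (simp only: power_add power_mult)
    then have p: "\<epsilon> ^ (a - b + (b - a)) = \<epsilon> ^ (a + b)"
      by (simp add: eps)
    have "real (a - b + (b - a)) ^ (2 * j) = (real a - real b) ^ (2 * j)"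
      by (cases "a \<le> b") (simp_all add: power_mult of_nat_diff power2_commute)
    then have "F (a - b + (b - a)) - F (a + b) =
        - (\<epsilon> ^ (a + b) * ((real a + real b) ^ (2 * j) - (real a - real b) ^ (2 * j)))"
      by (simp add: F_def p algebra_simps)
    also have "\<dots> = - (2 * (\<Sum>i<j. ?B i * (\<epsilon> ^ a * real a ^ (2 * i + 1) *
        (\<epsilon> ^ b * real b ^ (2 * j - 2 * i - 1)))))"
      unfolding binomial_odd_part by (simp add: sum_distrib_left power_add mult_ac)
    finally show ?thesis .
  qed
  have "fps_nth ?L n = 2 * (\<Sum>i<j. ?B i * (\<Sum>(a, b, x, y)\<in>bilinear_reps n.
      \<epsilon> ^ a * real a ^ (2 * i + 1) * (\<epsilon> ^ b * real b ^ (2 * j - 2 * i - 1))))"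
    by (simp add: twisted_sigma_series_def divisor_series_mult_nth fps_sum_nth numeral_fps_const
        flip: fps_of_nat)
  also have "\<dots> = (\<Sum>i<j. \<Sum>(a, b, x, y)\<in>bilinear_reps n.
      2 * (?B i * (\<epsilon> ^ a * real a ^ (2 * i + 1) * (\<epsilon> ^ b * real b ^ (2 * j - 2 * i - 1)))))"
    by (simp add: sum_distrib_left case_prod_unfold)
  also have "\<dots> = (\<Sum>(a, b, x, y)\<in>bilinear_reps n. \<Sum>i<j.
      2 * (?B i * (\<epsilon> ^ a * real a ^ (2 * i + 1) * (\<epsilon> ^ b * real b ^ (2 * j - 2 * i - 1)))))"
    by (subst sum.swap) (simp add: case_prod_unfold)
  also have "\<dots> = - (\<Sum>(a, b, x, y)\<in>bilinear_reps n. F (a - b + (b - a)) - F (a + b))"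
    unfolding F by (simp add: sum_negf case_prod_unfold sum_distrib_left)
  finally have L: "fps_nth ?L n = - (\<Sum>(a, b, x, y)\<in>bilinear_reps n.
      F (a - b + (b - a)) - F (a + b))" .
  show "fps_nth ?L n = fps_nth ?R n"
  proof (cases "n = 0")
    case True
    then show ?thesis
      unfolding L by (simp add: twisted_sigma_series_def divisor_series_def)
  next
    case False
    have "fps_nth ?L n = - (\<Sum>d | d dvd n. 2 * real (n div d) * F d + real d * F 0 - real d * F d
        - F 0 - F d - 2 * (\<Sum>k\<in>{1..<d}. F k))"
      unfolding L using False by (subst liouville_identity) auto
    also have "\<dots> = (\<Sum>d | d dvd n. \<epsilon> ^ d * real d ^ (2 * j + 1) -
        2 * (real n * (\<epsilon> ^ d * real d ^ (2 * j - 1))) +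
        (F d + 2 * (\<Sum>k<d. F k)))"
      unfolding sum_negf[symmetric]
    proof (rule sum.cong)
      fix d assume "d \<in> {d. d dvd n}"
      \<comment> \<open>The derivative term originates here:
        \<open>(n div d) d^(2j) = n d^(2j-1)\<close>.\<close>
      then have "real n = real (n div d) * real d"
        by (metis dvd_div_mult_self mem_Collect_eq of_nat_mult)
      moreover have "real d ^ (2 * j) = real d * real d ^ (2 * j - 1)"
        using \<open>j > 0\<close> by (simp flip: power_Suc)
      moreover have "(\<Sum>k<d. F k) = (\<Sum>k\<in>{1..<d}. F k)"
        by (rule sum.mono_neutral_right) (auto simp: F0 not_less_eq_eq)
      ultimately show "- (2 * real (n div d) * F d + real d * F 0 - real d * F d - F 0 - F d
          - 2 * (\<Sum>k\<in>{1..<d}. F k)) =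
          \<epsilon> ^ d * real d ^ (2 * j + 1) - 2 * (real n * (\<epsilon> ^ d * real d ^ (2 * j - 1))) +
          (F d + 2 * (\<Sum>k<d. F k))"
        by (simp add: F0) (simp add: F_def)
    qed simp
    also have "\<dots> = fps_nth ?R n"
      by (simp add: twisted_sigma_series_def divisor_series_def sum.distrib sum_subtractf
          sum_distrib_left F_def numeral_fps_const)
    finally show ?thesis .
  qed
qed

text \<open>A Faulhaber formula in trapezoidal form. \<open>step\<close> says that both sides grow
  alike from \<open>d\<close> to \<open>d + 1\<close>; the factor \<open>K\<close> clears
  denominators.\<close>

lemma twisted_power_sum:
  fixes \<epsilon> K :: real
  assumes "p 0 = 0" "0 < m"
    and step: "\<And>x. \<epsilon> * (p (x + 1) - K * (x + 1) ^ m) = p x + K * x ^ m"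
  shows "K * (\<epsilon> ^ d * real d ^ m + 2 * (\<Sum>k<d. \<epsilon> ^ k * real k ^ m)) = \<epsilon> ^ d * p (real d)"
proof (induction d)
  case 0
  then show ?case
    using assms by simp
next
  case (Suc d)
  have "\<epsilon> ^ Suc d * (p (real d + 1) - K * (real d + 1) ^ m) = \<epsilon> ^ d * (p (real d) + K * real d ^ m)"
    unfolding step[symmetric] by simp
  then show ?case
    using Suc by (simp add: algebra_simps)
qed

text \<open>Summing the closed form over divisors replaces the inner power sums by a combination of
  sigma series. Since \<open>0 \<notin> I\<close>, the polynomial vanishes at 0.\<close>

lemma divisor_series_power_sum:
  assumes "0 \<notin> I" "0 < j"
    and "\<And>x. \<epsilon> * ((\<Sum>r\<in>I. c r * (x + 1) ^ r) - K * (x + 1) ^ (2 * j)) =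
      (\<Sum>r\<in>I. c r * x ^ r) + K * x ^ (2 * j)"
  shows "fps_const K * divisor_series (\<lambda>d. \<epsilon> ^ d * real d ^ (2 * j) +
      2 * (\<Sum>k<d. \<epsilon> ^ k * real k ^ (2 * j))) =
    (\<Sum>r\<in>I. fps_const (c r) * twisted_sigma_series \<epsilon> r)"
proof (rule fps_ext)
  fix n
  have "(\<Sum>r\<in>I. c r * 0 ^ r) = 0"
    by (rule sum.neutral) (use assms(1) in \<open>auto simp: zero_power\<close>)
  then have eq: "K * (\<epsilon> ^ d * real d ^ (2 * j) + 2 * (\<Sum>k<d. \<epsilon> ^ k * real k ^ (2 * j))) =
      \<epsilon> ^ d * (\<Sum>r\<in>I. c r * real d ^ r)" for d
    using assms by (intro twisted_power_sum) auto
  have "(\<Sum>d | d dvd n. \<epsilon> ^ d * (\<Sum>r\<in>I. c r * real d ^ r)) =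
      (\<Sum>r\<in>I. \<Sum>d | d dvd n. c r * (\<epsilon> ^ d * real d ^ r))"
    by (subst sum.swap) (simp add: sum_distrib_left mult_ac)
  then have "(\<Sum>d | d dvd n. K * (\<epsilon> ^ d * real d ^ (2 * j) + 2 * (\<Sum>k<d. \<epsilon> ^ k * real k ^ (2 * j)))) =
      (\<Sum>r\<in>I. \<Sum>d | d dvd n. c r * (\<epsilon> ^ d * real d ^ r))"
    by (simp only: eq)
  then show "fps_nth (fps_const K * divisor_series (\<lambda>d. \<epsilon> ^ d * real d ^ (2 * j) +
        2 * (\<Sum>k<d. \<epsilon> ^ k * real k ^ (2 * j)))) n =
      fps_nth (\<Sum>r\<in>I. fps_const (c r) * twisted_sigma_series \<epsilon> r) n"
    by (simp only: twisted_sigma_series_def divisor_series_def fps_sum_nth fps_mult_left_const_nth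
        fps_nth_Abs_fps sum_distrib_left)
qed

abbreviation sigma_series :: "nat \<Rightarrow> real fps" where
  "sigma_series \<equiv> twisted_sigma_series 1"

abbreviation dagger_series :: "nat \<Rightarrow> real fps" where
  "dagger_series \<equiv> twisted_sigma_series (-1)"

lemma fps_const_minus_one: "fps_const (- 1) = (- 1 :: real fps)"
  by (metis fps_const_neg fps_const_1_eq_1)

lemma odd_binomials:
  "(4 choose 3) = (4::nat)" "(6 choose 3) = (20::nat)" "(6 choose 5) = (6::nat)"
  "(8 choose 3) = (56::nat)" "(8 choose 5) = (56::nat)" "(8 choose 7) = (8::nat)"
  "(10 choose 3) = (120::nat)" "(10 choose 5) = (252::nat)" "(10 choose 7) = (120::nat)"
  "(10 choose 9) = (10::nat)"
  by (simp_all add: binomial_fact' fact_numeral)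

lemma sigma_convolution_1:
  "12 * sigma_series 1 ^ 2 = 5 * sigma_series 3 + sigma_series 1 - 6 * qderiv (sigma_series 1)"
proof -
  \<comment> \<open>The data encode \<open>3 (d^2 + 2 \<Sum>k<d. k^2) = 2 d^3 + d\<close>.\<close>
  let ?c = "\<lambda>r::nat. if r = 1 then 1 else 2 :: real"
  have "1 * ((\<Sum>r\<in>{1, 3}. ?c r * (x + 1) ^ r) - 3 * (x + 1) ^ (2 * 1)) =
      (\<Sum>r\<in>{1, 3}. ?c r * x ^ r) + 3 * x ^ (2 * 1)" for x :: real
    by (simp, algebra)
  from divisor_series_power_sum[OF _ _ this] twisted_sigma_convolution[of 1 1]
  show ?thesis
    by (simp add: power2_eq_square flip: numeral_fps_const neg_numeral_fps_const) algebra
qed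

lemma sigma_convolution_2:
  "240 * sigma_series 1 * sigma_series 3 =
     21 * sigma_series 5 + 10 * sigma_series 3 - sigma_series 1 - 30 * qderiv (sigma_series 3)"
proof -
  let ?c = "\<lambda>r::nat. if r = 1 then -1 else if r = 3 then 10 else 6 :: real"
  have "1 * ((\<Sum>r\<in>{1, 3, 5}. ?c r * (x + 1) ^ r) - 15 * (x + 1) ^ (2 * 2)) =
      (\<Sum>r\<in>{1, 3, 5}. ?c r * x ^ r) + 15 * x ^ (2 * 2)" for x :: real
    by (simp, algebra)
  from divisor_series_power_sum[OF _ _ this] twisted_sigma_convolution[of 1 2]
  show ?thesis
    by (simp add: lessThan_nat_numeral odd_binomials fps_const_minus_one
        flip: numeral_fps_const neg_numeral_fps_const) algebra
qed

text \<open>For alternating sums the closed form has degree only \<open>2j - 1\<close>, so the top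
  series enters with coefficient 1. In this lemma and the next four, the linear coefficients 1, -1,
  3, -17, 155 are Genocchi numbers up to sign.\<close>

lemma dagger_convolution_1:
  "4 * dagger_series 1 ^ 2 = dagger_series 3 - 2 * qderiv (dagger_series 1) + dagger_series 1"
proof -
  have "(-1) * ((\<Sum>r\<in>{1}. 1 * (x + 1) ^ r) - 1 * (x + 1) ^ (2 * 1)) =
      (\<Sum>r\<in>{1}. 1 * x ^ r) + 1 * x ^ (2 * 1)" for x :: real
    by (simp, algebra)
  from divisor_series_power_sum[OF _ _ this] twisted_sigma_convolution[of "-1" 1]
  show ?thesis
    by (simp add: power2_eq_square flip: numeral_fps_const neg_numeral_fps_const)
qed

lemma dagger_convolution_2:
  "16 * dagger_series 1 * dagger_series 3 =
     dagger_series 5 - 2 * qderiv (dagger_series 3) + 2 * dagger_series 3 - dagger_series 1"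
proof -
  let ?c = "\<lambda>r::nat. if r = 1 then -1 else 2 :: real"
  have "(-1) * ((\<Sum>r\<in>{1, 3}. ?c r * (x + 1) ^ r) - 1 * (x + 1) ^ (2 * 2)) =
      (\<Sum>r\<in>{1, 3}. ?c r * x ^ r) + 1 * x ^ (2 * 2)" for x :: real
    by (simp, algebra)
  from divisor_series_power_sum[OF _ _ this] twisted_sigma_convolution[of "-1" 2]
  show ?thesis
    by (simp add: lessThan_nat_numeral odd_binomials fps_const_minus_one
        flip: numeral_fps_const neg_numeral_fps_const) algebra
qed

lemma dagger_convolution_3:
  "24 * dagger_series 1 * dagger_series 5 + 40 * dagger_series 3 ^ 2 =
     dagger_series 7 - 2 * qderiv (dagger_series 5) + 3 * dagger_series 5 - 5 * dagger_series 3 +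
     3 * dagger_series 1"
proof -
  let ?c = "\<lambda>r::nat. if r = 1 then 3 else if r = 3 then -5 else 3 :: real"
  have "(-1) * ((\<Sum>r\<in>{1, 3, 5}. ?c r * (x + 1) ^ r) - 1 * (x + 1) ^ (2 * 3)) =
      (\<Sum>r\<in>{1, 3, 5}. ?c r * x ^ r) + 1 * x ^ (2 * 3)" for x :: real
    by (simp, algebra)
  from divisor_series_power_sum[OF _ _ this] twisted_sigma_convolution[of "-1" 3]
  show ?thesis
    by (simp add: lessThan_nat_numeral odd_binomials fps_const_minus_one
        flip: numeral_fps_const neg_numeral_fps_const) algebra
qed

lemma dagger_convolution_4:
  "32 * dagger_series 1 * dagger_series 7 + 224 * dagger_series 3 * dagger_series 5 =
     dagger_series 9 - 2 * qderiv (dagger_series 7) + 4 * dagger_series 7 - 14 * dagger_series 5 +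
     28 * dagger_series 3 - 17 * dagger_series 1"
proof -
  let ?c = "\<lambda>r::nat. if r = 1 then -17 else if r = 3 then 28 else if r = 5 then -14 else 4 :: real"
  have "(-1) * ((\<Sum>r\<in>{1, 3, 5, 7}. ?c r * (x + 1) ^ r) - 1 * (x + 1) ^ (2 * 4)) =
      (\<Sum>r\<in>{1, 3, 5, 7}. ?c r * x ^ r) + 1 * x ^ (2 * 4)" for x :: real
    by (simp, algebra)
  from divisor_series_power_sum[OF _ _ this] twisted_sigma_convolution[of "-1" 4]
  show ?thesis
    by (simp add: lessThan_nat_numeral odd_binomials fps_const_minus_one
        flip: numeral_fps_const neg_numeral_fps_const) algebra
qed

lemma dagger_convolution_5:
  "40 * dagger_series 1 * dagger_series 9 + 480 * dagger_series 3 * dagger_series 7 +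
     504 * dagger_series 5 ^ 2 =
     dagger_series 11 - 2 * qderiv (dagger_series 9) + 5 * dagger_series 9 - 30 * dagger_series 7 +
     126 * dagger_series 5 - 255 * dagger_series 3 + 155 * dagger_series 1"
proof -
  let ?c = "\<lambda>r::nat. if r = 1 then 155 else if r = 3 then -255 else if r = 5 then 126 else
      if r = 7 then -30 else 5 :: real"
  have "(-1) * ((\<Sum>r\<in>{1, 3, 5, 7, 9}. ?c r * (x + 1) ^ r) - 1 * (x + 1) ^ (2 * 5)) =
      (\<Sum>r\<in>{1, 3, 5, 7, 9}. ?c r * x ^ r) + 1 * x ^ (2 * 5)" for x :: real
    by (simp, algebra)
  from divisor_series_power_sum[OF _ _ this] twisted_sigma_convolution[of "-1" 5]
  show ?thesis
    by (simp add: lessThan_nat_numeral odd_binomials fps_const_minus_one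
        flip: numeral_fps_const neg_numeral_fps_const) algebra
qed

section \<open>Eisenstein series of levels 1 and 2\<close>

definition eisenstein2 :: "real fps" where "eisenstein2 = 1 - 24 * sigma_series 1"
definition eisenstein4 :: "real fps" where "eisenstein4 = 1 + 240 * sigma_series 3"
definition eisenstein6 :: "real fps" where "eisenstein6 = 1 - 504 * sigma_series 5"

section \<open>Replacing \<open>q\<close> by \<open>q^2\<close>\<close>

definition dilate :: "real fps \<Rightarrow> real fps" where
  "dilate f = f oo fps_X ^ 2"

lemma dilate_simps [simp]:
  "dilate (f + g) = dilate f + dilate g" "dilate (f - g) = dilate f - dilate g"
  "dilate (f * g) = dilate f * dilate g" "dilate (numeral k) = numeral k" "dilate 1 = 1"
  by (simp_all add: dilate_def fps_compose_add_distrib fps_compose_sub_distrib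
      fps_compose_mult_distrib numeral_fps_const)

lemma dilate_power [simp]: "dilate (f ^ k) = dilate f ^ k"
  by (induction k) simp_all

lemma dilate_nth: "fps_nth (dilate f) n = (if even n then fps_nth f (n div 2) else 0)"
proof -
  have "fps_nth (dilate f) n = (\<Sum>i=0..n. fps_nth f i * (if n = 2 * i then 1 else 0))"
    by (simp add: dilate_def fps_compose_nth fps_X_power_nth flip: power_mult)
  also have "\<dots> = (\<Sum>i\<in>{0..n}. if i = n div 2 \<and> even n then fps_nth f i else 0)"
    by (rule sum.cong) auto
  also have "\<dots> = (if even n then fps_nth f (n div 2) else 0)"
    by (cases "even n") auto
  finally show ?thesis .
qed

lemma qderiv_dilate: "qderiv (dilate f) = 2 * dilate (qderiv f)"
  by (rule fps_ext) (auto simp: dilate_nth numeral_fps_const)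

text \<open>The sign \<open>(-1)^d\<close> is twice the indicator of even \<open>d\<close>, minus 1.
  The even divisors are the \<open>2 d\<close> with \<open>2 d\<close> dividing \<open>n\<close>,
  which contribute \<open>2^r d^r\<close>.\<close>

lemma dagger_series_dilate:
  "dagger_series r = fps_const (2 ^ Suc r) * dilate (sigma_series r) - sigma_series r"
proof (rule fps_ext)
  fix n
  have "fps_nth (dilate (sigma_series r)) n =
      (if even n then \<Sum>d | d dvd n div 2. real d ^ r else 0)"
    by (simp add: dilate_nth twisted_sigma_series_def divisor_series_def)
  also have "\<dots> = (\<Sum>d | 2 * d dvd n. real d ^ r)"
  proof (cases "even n")
    case True
    then have "{d. d dvd n div 2} = {d. 2 * d dvd n}"
      by (auto elim!: evenE)
    then show ?thesis using True by simp
  next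
    case False
    then have "{d. 2 * d dvd n} = {}"
      by (auto dest: dvd_mult_left)
    then show ?thesis using False by (simp only: sum.empty if_False)
  qed
  finally have dil: "fps_nth (dilate (sigma_series r)) n = (\<Sum>d | 2 * d dvd n. real d ^ r)" .
  show "fps_nth (dagger_series r) n =
      fps_nth (fps_const (2 ^ Suc r) * dilate (sigma_series r) - sigma_series r) n"
  proof (cases "n = 0")
    case True
    then show ?thesis
      by (simp add: dilate_nth twisted_sigma_series_def divisor_series_def)
  next
    case False
    then have fin: "finite {d. d dvd n}"
      by (simp add: finite_divisors_nat)
    have "fps_nth (dagger_series r) n =
        (\<Sum>d | d dvd n. 2 * (if even d then real d ^ r else 0) - real d ^ r)"
      unfolding twisted_sigma_series_def divisor_series_def fps_nth_Abs_fps
      by (rule sum.cong) auto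
    also have "\<dots> = 2 * (\<Sum>d\<in>{d\<in>{d. d dvd n}. even d}. real d ^ r) - fps_nth (sigma_series r) n"
      using fin by (simp add: sum_subtractf sum_distrib_left[symmetric] sum.inter_filter[symmetric]
          twisted_sigma_series_def divisor_series_def)
    also have "(\<Sum>d\<in>{d\<in>{d. d dvd n}. even d}. real d ^ r) = (\<Sum>d | 2 * d dvd n. real (2 * d) ^ r)"
      by (rule sum.reindex_bij_witness[of _ "\<lambda>d. 2 * d" "\<lambda>d. d div 2"]) auto
    also have "\<dots> = 2 ^ r * (\<Sum>d | 2 * d dvd n. real d ^ r)"
      by (simp add: power_mult_distrib sum_distrib_left)
    finally show ?thesis
      using dil by simp
  qed
qed

definition dagger_eisenstein2 :: "real fps" where "dagger_eisenstein2 = 1 - 8 * dagger_series 1"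
definition dagger_eisenstein4 :: "real fps" where "dagger_eisenstein4 = 1 + 16 * dagger_series 3"
text \<open>The non-modular parts of \<open>E\<^sub>2\<close> cancel in this combination: it is the
  Eisenstein series of weight 2 and level 2.\<close>

definition level_two_eisenstein2 :: "real fps" where
  "level_two_eisenstein2 = 2 * dilate eisenstein2 - eisenstein2"

section \<open>Differential equations and polynomial relations\<close>

context
  fixes A B G H F K P Q e :: "real fps"
  defines "A \<equiv> eisenstein2" and "B \<equiv> dilate eisenstein2"
    and "G \<equiv> eisenstein4" and "F \<equiv> dilate eisenstein4"
    and "H \<equiv> eisenstein6" and "K \<equiv> dilate eisenstein6"
    and "P \<equiv> dagger_eisenstein2" and "Q \<equiv> dagger_eisenstein4" and "e \<equiv> level_two_eisenstein2"
begin

lemma level_two_eisenstein2_eq: "e = 2 * B - A"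
  by (simp add: e_def A_def B_def level_two_eisenstein2_def)

lemma qderiv_eisenstein2: "12 * qderiv A = A ^ 2 - G"
  using sigma_convolution_1 unfolding A_def G_def eisenstein2_def eisenstein4_def
  by simp algebra

lemma qderiv_dilate_eisenstein2: "6 * qderiv B = B ^ 2 - F"
proof -
  have "6 * qderiv B = dilate (12 * qderiv A)"
    by (simp add: B_def A_def qderiv_dilate)
  also have "\<dots> = B ^ 2 - F"
    unfolding qderiv_eisenstein2 by (simp add: A_def B_def G_def F_def)
  finally show ?thesis .
qed

lemma qderiv_eisenstein4: "3 * qderiv G = A * G - H"
  using sigma_convolution_2 unfolding A_def G_def H_def eisenstein2_def eisenstein4_def
    eisenstein6_def
  by simp algebra

lemma qderiv_dilate_eisenstein4: "3 * qderiv F = 2 * (B * F - K)"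
proof -
  have "3 * qderiv F = 2 * dilate (3 * qderiv G)"
    by (simp add: F_def G_def qderiv_dilate)
  also have "\<dots> = 2 * (B * F - K)"
    unfolding qderiv_eisenstein4 by (simp add: A_def B_def G_def F_def H_def K_def)
  finally show ?thesis .
qed

lemma dagger_eisenstein2_eq: "3 * P = 4 * B - A"
  unfolding P_def A_def B_def dagger_eisenstein2_def eisenstein2_def
  using dagger_series_dilate[of 1] by (simp add: power2_eq_square flip: numeral_fps_const)

lemma dagger_eisenstein4_eq: "15 * Q = 16 * F - G"
  unfolding Q_def F_def G_def dagger_eisenstein4_def eisenstein4_def
  using dagger_series_dilate[of 3] by (simp flip: numeral_fps_const)

lemma dagger_eisenstein6_eq: "63 * (1 - 8 * dagger_series 5) = 64 * K - H"
  unfolding K_def H_def eisenstein6_def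
  using dagger_series_dilate[of 5] by (simp flip: numeral_fps_const)

lemma qderiv_dagger_eisenstein2: "4 * qderiv P = P ^ 2 - Q"
  using dagger_convolution_1 unfolding P_def Q_def dagger_eisenstein2_def dagger_eisenstein4_def
  by simp algebra

lemma qderiv_dagger_eisenstein4: "qderiv Q = P * Q - (1 - 8 * dagger_series 5)"
  using dagger_convolution_2 unfolding P_def Q_def dagger_eisenstein2_def dagger_eisenstein4_def
  by simp algebra

text \<open>Both sides arise by computing \<open>D P\<close> once at level 2 and once from \<open>3 P = 4 B - A\<close>.\<close>

lemma level_two_eisenstein2_square: "G + 4 * F = 5 * e ^ 2"
proof -
  have "3 * qderiv P = 4 * qderiv B - qderiv A"
    using arg_cong[OF dagger_eisenstein2_eq, of qderiv] by simp
  \<comment> \<open>Elimination yields twice the claim; power series over the reals form a domain,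
    so the factor cancels.\<close>
  then have "2 * (G + 4 * F) = 2 * (5 * e ^ 2)"
    using qderiv_eisenstein2 qderiv_dilate_eisenstein2 qderiv_dagger_eisenstein2
      dagger_eisenstein2_eq dagger_eisenstein4_eq level_two_eisenstein2_eq by algebra
  then show ?thesis
    by (simp only: mult_cancel_left) simp
qed

text \<open>Two linear equations, \<open>G + 4 F = 5 e^2\<close> and \<open>16 F - G = 15 Q\<close>,
  solved for \<open>G\<close> and \<open>F\<close>.\<close>

lemma eisenstein4_eq: "G = 4 * e ^ 2 - 3 * Q" and dilate_eisenstein4_eq: "4 * F = e ^ 2 + 3 * Q"
proof -
  have "5 * G = 5 * (4 * e ^ 2 - 3 * Q)"
    using level_two_eisenstein2_square dagger_eisenstein4_eq by algebra
  then show "G = 4 * e ^ 2 - 3 * Q"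
    by (simp only: mult_cancel_left) simp
  have "5 * (4 * F) = 5 * (e ^ 2 + 3 * Q)"
    using level_two_eisenstein2_square dagger_eisenstein4_eq by algebra
  then show "4 * F = e ^ 2 + 3 * Q"
    by (simp only: mult_cancel_left) simp
qed

lemma eisenstein2_eq: "A = 3 * P - 2 * e" and dilate_eisenstein2_eq: "2 * B = 3 * P - e"
  using dagger_eisenstein2_eq level_two_eisenstein2_eq by algebra+

text \<open>Once the equations for \<open>A\<close> and \<open>B\<close> are written in
  \<open>P\<close>, \<open>e\<close> and \<open>Q\<close>, the terms in \<open>P^2\<close> and
  \<open>e^2\<close> cancel.\<close>

lemma qderiv_level_two_eisenstein2: "2 * qderiv e = e * P - Q"
proof -
  have "qderiv e = 2 * qderiv B - qderiv A"
    by (simp add: level_two_eisenstein2_eq)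
  then have "12 * (2 * qderiv e) = 12 * (e * P - Q)"
    using qderiv_eisenstein2 qderiv_dilate_eisenstein2 eisenstein2_eq dilate_eisenstein2_eq
      eisenstein4_eq dilate_eisenstein4_eq by algebra
  then show ?thesis
    by (simp only: mult_cancel_left) simp
qed

text \<open>Differentiating the expressions of \<open>G\<close> and \<open>F\<close> in
  \<open>e\<close> and \<open>Q\<close>, and comparing with Ramanujan's equations, determines
  \<open>H\<close> and \<open>K\<close> in terms of \<open>?R\<close>. Then
  \<open>63 ?R = 64 K - H\<close> is a linear equation for \<open>?R\<close>.\<close>

lemma dagger_eisenstein6_factor: "1 - 8 * dagger_series 5 = e * Q"
proof -
  let ?R = "1 - 8 * dagger_series 5"
  have "qderiv G = 4 * (2 * e * qderiv e) - 3 * qderiv Q"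
    by (simp add: eisenstein4_eq power2_eq_square)
  then have "H = A * G - 12 * (e * P - Q) * e + 9 * (P * Q - ?R)"
    using qderiv_eisenstein4 qderiv_level_two_eisenstein2 qderiv_dagger_eisenstein4 by algebra
  moreover have "4 * qderiv F = 2 * e * qderiv e + 3 * qderiv Q"
    using arg_cong[OF dilate_eisenstein4_eq, of qderiv] by (simp add: power2_eq_square)
  then have "8 * K = 8 * B * F - 3 * (e * P - Q) * e - 9 * (P * Q - ?R)"
    using qderiv_dilate_eisenstein4 qderiv_level_two_eisenstein2 qderiv_dagger_eisenstein4
    by algebra
  \<comment> \<open>\<open>64 K - H\<close> contains \<open>81 ?R\<close>, and
    \<open>81 - 63 = 18\<close>.\<close>
  ultimately have "18 * ?R = 18 * (e * Q)"
    using dagger_eisenstein6_eq eisenstein2_eq dilate_eisenstein2_eq dilate_eisenstein4_eq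
      eisenstein4_eq by algebra
  then show ?thesis
    by (simp only: mult_cancel_left) simp
qed

text \<open>The convolution for \<open>j = 3\<close> yields \<open>S\<^sub>7\<close> once
  \<open>D S\<^sub>5\<close> is known, which comes from differentiating
  \<open>1 - 8 S\<^sub>5 = e Q\<close>; \<open>P\<close> drops out. Weights 10 and 12 repeat the
  pattern.\<close>

lemma dagger_eisenstein8_eq: "17 + 32 * dagger_series 7 = 8 * e ^ 2 * Q + 9 * Q ^ 2"
proof -
  have "qderiv (1 - 8 * dagger_series 5) = qderiv e * Q + e * qderiv Q"
    unfolding dagger_eisenstein6_factor by simp
  then have "- 8 * qderiv (dagger_series 5) = qderiv e * Q + e * qderiv Q"
    by simp
  then show ?thesis
    using dagger_convolution_3 dagger_eisenstein6_factor qderiv_level_two_eisenstein2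
      qderiv_dagger_eisenstein4
    unfolding P_def Q_def dagger_eisenstein2_def dagger_eisenstein4_def by algebra
qed

lemma dagger_eisenstein10_eq: "31 - 8 * dagger_series 9 = 4 * e ^ 3 * Q + 27 * e * Q ^ 2"
proof -
  have "qderiv (17 + 32 * dagger_series 7) =
      16 * e * qderiv e * Q + 8 * e ^ 2 * qderiv Q + 18 * Q * qderiv Q"
    unfolding dagger_eisenstein8_eq by (simp add: power2_eq_square)
  then have "32 * qderiv (dagger_series 7) =
      16 * e * qderiv e * Q + 8 * e ^ 2 * qderiv Q + 18 * Q * qderiv Q"
    by simp
  then show ?thesis
    using dagger_convolution_4 dagger_eisenstein6_factor dagger_eisenstein8_eq
      qderiv_level_two_eisenstein2 qderiv_dagger_eisenstein4
    unfolding P_def Q_def dagger_eisenstein2_def dagger_eisenstein4_def by algebra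
qed

text \<open>The constant is \<open>16 + 486 + 189 = 691\<close>, the numerator of the Bernoulli
  number \<open>B\<^sub>1\<^sub>2\<close> up to sign.\<close>

lemma dagger_eisenstein12_eq:
  "691 + 16 * dagger_series 11 = 16 * e ^ 4 * Q + 486 * e ^ 2 * Q ^ 2 + 189 * Q ^ 3"
proof -
  have "qderiv (31 - 8 * dagger_series 9) =
      12 * e ^ 2 * qderiv e * Q + 4 * e ^ 3 * qderiv Q + 27 * qderiv e * Q ^ 2 +
        54 * e * Q * qderiv Q"
    unfolding dagger_eisenstein10_eq by (simp add: power2_eq_square power3_eq_cube)
  then have "- 8 * qderiv (dagger_series 9) =
      12 * e ^ 2 * qderiv e * Q + 4 * e ^ 3 * qderiv Q + 27 * qderiv e * Q ^ 2 +
        54 * e * Q * qderiv Q"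
    by simp
  then show ?thesis
    using dagger_convolution_5 dagger_eisenstein6_factor dagger_eisenstein8_eq
      dagger_eisenstein10_eq qderiv_level_two_eisenstein2 qderiv_dagger_eisenstein4
    unfolding P_def Q_def dagger_eisenstein2_def dagger_eisenstein4_def by algebra
qed

text \<open>The logarithmic derivatives of \<open>Q\<close> and \<open>e^2 - Q\<close> are
  \<open>P - e\<close> and \<open>P\<close>, and \<open>2 (P - e) + P = A\<close>.\<close>

lemma qderiv_discriminant: "qderiv (Q ^ 2 * (e ^ 2 - Q)) = A * (Q ^ 2 * (e ^ 2 - Q))"
proof -
  have "qderiv (Q ^ 2 * (e ^ 2 - Q)) =
      2 * Q * qderiv Q * (e ^ 2 - Q) + Q ^ 2 * (2 * e * qderiv e - qderiv Q)"
    by (simp add: power2_eq_square)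
  then show ?thesis
    using qderiv_level_two_eisenstein2 qderiv_dagger_eisenstein4 dagger_eisenstein6_factor
      eisenstein2_eq by algebra
qed

text \<open>Here \<open>(P - e) + 2 P = 2 B\<close>, the logarithmic derivative of
  \<open>\<Delta>(q^2)\<close>.\<close>

lemma qderiv_dilate_discriminant: "qderiv (Q * (e ^ 2 - Q) ^ 2) = 2 * B * (Q * (e ^ 2 - Q) ^ 2)"
proof -
  have "qderiv (Q * (e ^ 2 - Q) ^ 2) =
      qderiv Q * (e ^ 2 - Q) ^ 2 + 2 * Q * (e ^ 2 - Q) * (2 * e * qderiv e - qderiv Q)"
    by (simp add: power2_eq_square)
  then show ?thesis
    using qderiv_level_two_eisenstein2 qderiv_dagger_eisenstein4 dagger_eisenstein6_factor
      dilate_eisenstein2_eq by algebra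
qed

end

section \<open>The discriminant\<close>

text \<open>The hypotheses state logarithmic derivatives without division, so integer coefficients
  are allowed; such derivatives add under products.\<close>

lemma fps_X_deriv_mult:
  fixes f h :: "'a :: comm_ring_1 fps"
  assumes "fps_X * fps_deriv f = f * g" "fps_X * fps_deriv h = h * k"
  shows "fps_X * fps_deriv (f * h) = f * h * (g + k)"
proof -
  have "fps_X * fps_deriv (f * h) = (fps_X * fps_deriv f) * h + f * (fps_X * fps_deriv h)"
    by (simp add: algebra_simps)
  then show ?thesis
    unfolding assms by (simp add: algebra_simps)
qed

lemma fps_X_deriv_power:
  fixes f :: "'a :: comm_ring_1 fps"
  assumes "fps_X * fps_deriv f = f * g"
  shows "fps_X * fps_deriv (f ^ n) = f ^ n * (of_nat n * g)"
proof (induction n)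
  case (Suc n)
  from fps_X_deriv_mult[OF assms Suc.IH] show ?case
    by (simp add: algebra_simps)
qed simp

lemma fps_X_deriv_prod:
  fixes f :: "'b \<Rightarrow> 'a :: comm_ring_1 fps"
  assumes "\<And>i. i \<in> I \<Longrightarrow> fps_X * fps_deriv (f i) = f i * g i"
  shows "fps_X * fps_deriv (prod f I) = prod f I * sum g I"
  using assms
proof (induction I rule: infinite_finite_induct)
  case (insert i I)
  then show ?case
    using fps_X_deriv_mult[of "f i" "g i" "prod f I" "sum g I"] by simp
qed simp_all

text \<open>The last factor is the geometric series \<open>-m (X^m + X^(2m) + ...)\<close>;
  multiplying by \<open>1 - X^m\<close> telescopes it to \<open>-m X^m\<close>.\<close>

lemma fps_X_deriv_one_minus_X_power:
  assumes "m > 0"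
  shows "fps_X * fps_deriv (1 - fps_X ^ m) =
    (1 - fps_X ^ m) * Abs_fps (\<lambda>k. if 0 < k \<and> m dvd k then - int m else 0)"
proof (rule fps_ext)
  fix k
  have "fps_nth (fps_X * fps_deriv (1 - fps_X ^ m)) k = (if k = m then - int m else 0)"
    using assms by (cases k) (auto simp: fps_X_power_nth)
  also have "\<dots> = (if 0 < k \<and> m dvd k then - int m else 0) -
      (if k < m then 0 else if 0 < k - m \<and> m dvd k - m then - int m else 0)"
    using assms by (auto simp: dvd_minus_self dest: dvd_imp_le)
  also have "\<dots> = fps_nth ((1 - fps_X ^ m) * Abs_fps (\<lambda>k. if 0 < k \<and> m dvd k then - int m else 0)) k"
    by (simp add: left_diff_distrib fps_X_power_mult_nth)
  finally show "fps_nth (fps_X * fps_deriv (1 - fps_X ^ m)) k =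
    fps_nth ((1 - fps_X ^ m) * Abs_fps (\<lambda>k. if 0 < k \<and> m dvd k then - int m else 0)) k" .
qed

section \<open>The product \<open>\<Delta>(q) / q\<close> and its coefficients\<close>

definition eta24 :: "int fps" where
  "eta24 = (\<Prod>r. (1 - fps_X ^ Suc r) ^ 24)"

text \<open>Convergence in the \<open>X\<close>-adic topology makes each coefficient eventually
  constant, and finitely many coefficients can share one bound.\<close>

lemma eta24_nth_eventually:
  "eventually (\<lambda>N. \<forall>k\<in>{..n}. fps_nth (\<Prod>r\<le>N. (1 - fps_X ^ Suc r) ^ 24) k =
      fps_nth eta24 k) sequentially"
proof -
  have "(\<lambda>r. (1 - fps_X ^ Suc r) ^ 24 :: int fps) has_prod eta24"
    using has_prod_eta24 has_prod_unique[OF has_prod_eta24] by (simp add: eta24_def)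
  then have "(\<lambda>N. \<Prod>r\<le>N. (1 - fps_X ^ Suc r) ^ 24) \<longlonglongrightarrow> eta24"
    by (simp add: has_prod_imp_tendsto)
  then show ?thesis
    by (intro eventually_ball_finite) (auto simp: tendsto_fps_iff)
qed

lemma eta24_0: "fps_nth eta24 0 = 1"
proof -
  obtain N where "fps_nth (\<Prod>r\<le>N. (1 - fps_X ^ Suc r) ^ 24 :: int fps) 0 = fps_nth eta24 0"
    using eventually_happens'[OF _ eta24_nth_eventually[of 0]] by auto
  moreover have "fps_nth (\<Prod>r\<le>N. (1 - fps_X ^ Suc r) ^ 24 :: int fps) 0 = 1"
    by (induction N) (simp_all add: fps_nth_power_0)
  ultimately show ?thesis
    by simp
qed

text \<open>A sufficiently long partial product agrees with \<open>eta24\<close> up to degree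
  \<open>n\<close>, and up to that degree its logarithmic derivative is already \<open>-24\<close>
  times the series of divisor sums.\<close>

lemma eta24_recurrence:
  "int n * fps_nth eta24 n = - 24 * (\<Sum>i=0..n. fps_nth eta24 i * (\<Sum>d | d dvd n - i. int d))"
proof -
  define p where "p = (\<lambda>N. \<Prod>r\<le>N. (1 - fps_X ^ Suc r) ^ 24 :: int fps)"
  define g where "g = (\<lambda>m. Abs_fps (\<lambda>k. if 0 < k \<and> m dvd k then - int m else 0))"
  have "eventually (\<lambda>N. (\<forall>k\<in>{..n}. fps_nth (p N) k = fps_nth eta24 k) \<and> n \<le> N) sequentially"
    unfolding p_def by (intro eventually_conj eta24_nth_eventually eventually_ge_at_top)
  then obtain N where p: "\<And>k. k \<le> n \<Longrightarrow> fps_nth (p N) k = fps_nth eta24 k" and "n \<le> N"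
    using eventually_happens' by force
  have g: "fps_nth (\<Sum>r\<le>N. of_nat 24 * g (Suc r)) k = - 24 * (\<Sum>d | d dvd k. int d)" if "k \<le> n" for k
  proof (cases "k = 0")
    case False
    have "fps_nth (\<Sum>r\<le>N. of_nat 24 * g (Suc r)) k =
        24 * (\<Sum>r\<le>N. if Suc r dvd k then - int (Suc r) else 0)"
      using False by (simp add: fps_sum_nth g_def sum_distrib_left numeral_fps_const)
    also have "(\<Sum>r\<le>N. if Suc r dvd k then - int (Suc r) else 0) =
        (\<Sum>r | r \<le> N \<and> Suc r dvd k. - int (Suc r))"
      by (simp add: sum.If_cases Collect_conj_eq atMost_def)
    also have "\<dots> = (\<Sum>d | d dvd k. - int d)"
    proof -
      \<comment> \<open>No divisor is missed, as \<open>d \<le> k \<le> n \<le> N\<close>; the shift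
        by \<open>Suc\<close> reflects the product starting at index 0.\<close>
      have "{d. d dvd k} = Suc ` {r. r \<le> N \<and> Suc r dvd k}"
      proof (intro equalityI subsetI)
        fix d assume "d \<in> {d. d dvd k}"
        then have d: "d dvd k" "d \<le> k"
          using False by (simp_all add: dvd_imp_le)
        with False obtain r where "d = Suc r"
          by (cases d) auto
        with d \<open>k \<le> n\<close> \<open>n \<le> N\<close> show "d \<in> Suc ` {r. r \<le> N \<and> Suc r dvd k}"
          by simp
      qed auto
      then show ?thesis
        by (simp add: sum.reindex)
    qed
    finally show ?thesis
      by (simp add: sum_negf)
  qed (simp add: fps_sum_nth g_def numeral_fps_const)
  have "fps_X * fps_deriv (p N) = p N * (\<Sum>r\<le>N. of_nat 24 * g (Suc r))"
    unfolding p_def g_def by (intro fps_X_deriv_prod fps_X_deriv_power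
        fps_X_deriv_one_minus_X_power) simp
  moreover have "fps_nth (fps_X * fps_deriv (p N)) n = int n * fps_nth (p N) n"
    by (cases n) simp_all
  ultimately have "int n * fps_nth (p N) n =
      (\<Sum>i=0..n. fps_nth (p N) i * fps_nth (\<Sum>r\<le>N. of_nat 24 * g (Suc r)) (n - i))"
    by (simp only: fps_mult_nth)
  also have "\<dots> = (\<Sum>i=0..n. - 24 * (fps_nth eta24 i * (\<Sum>d | d dvd n - i. int d)))"
    by (rule sum.cong) (simp_all add: p g[simplified])
  finally show ?thesis
    using p by (simp add: sum_distrib_left)
qed

definition tau_series :: "real fps" where
  "tau_series = Abs_fps (\<lambda>n. real_of_int (ramanujan_tau n))"

lemma tau_series_eq: "tau_series = fps_X * Abs_fps (\<lambda>n. real_of_int (fps_nth eta24 n))"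
  by (rule fps_ext) (simp add: tau_series_def ramanujan_tau_def eta24_def)

text \<open>In the logarithmic derivative the leading factor \<open>q\<close> contributes 1 and the
  product contributes \<open>-24 S\<close> with \<open>S = sigma_series 1\<close>.\<close>

lemma qderiv_tau_series: "qderiv tau_series = eisenstein2 * tau_series"
proof -
  define L where "L = Abs_fps (\<lambda>n. real_of_int (fps_nth eta24 n))"
  have "qderiv L = - 24 * (L * sigma_series 1)"
  proof (rule fps_ext)
    fix n
    have conv: "fps_nth (L * sigma_series 1) n =
        (\<Sum>i=0..n. real_of_int (fps_nth eta24 i) * (\<Sum>d | d dvd n - i. real d))"
      by (simp add: L_def twisted_sigma_series_def divisor_series_def fps_mult_nth)
    have "fps_nth (qderiv L) n = real_of_int (int n * fps_nth eta24 n)"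
      by (simp add: L_def)
    also have "\<dots> = - 24 * (\<Sum>i=0..n. real_of_int (fps_nth eta24 i) * (\<Sum>d | d dvd n - i. real d))"
      unfolding eta24_recurrence by simp
    also have "\<dots> = fps_nth (- 24 * (L * sigma_series 1)) n"
      by (simp only: conv neg_numeral_fps_const fps_mult_left_const_nth)
    finally show "fps_nth (qderiv L) n = fps_nth (- 24 * (L * sigma_series 1)) n" .
  qed
  moreover have "qderiv fps_X = fps_X"
    by (simp add: qderiv_def)
  ultimately show ?thesis
    unfolding tau_series_eq L_def[symmetric] eisenstein2_def by (simp add: algebra_simps)
qed

text \<open>Comparing coefficients gives \<open>(n - 1) f\<^sub>n\<close> in terms of earlier
  coefficients, so \<open>f\<^sub>1\<close> is the only free one.\<close>

lemma qderiv_linear_unique: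
  assumes "qderiv f = g * f" "fps_nth g 0 = 1" "fps_nth f 1 = 0"
  shows "f = 0"
proof (rule fps_ext)
  fix n
  show "fps_nth f n = fps_nth 0 n"
  proof (induction n rule: less_induct)
    case (less n)
    have "real n * fps_nth f n = (\<Sum>i=0..n. fps_nth g i * fps_nth f (n - i))"
      using arg_cong[OF assms(1), of "\<lambda>h. fps_nth h n"] by (simp add: fps_mult_nth)
    also have "\<dots> = (\<Sum>i\<in>{0}. fps_nth g i * fps_nth f (n - i))"
      by (rule sum.mono_neutral_right) (auto simp: less)
    finally have "(real n - 1) * fps_nth f n = 0"
      using assms(2) by (simp add: algebra_simps)
    then show ?case
      using assms(3) by auto
  qed
qed

text \<open>For odd \<open>n\<close> and even \<open>i > 0\<close> the index \<open>n - i\<close> is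
  odd and smaller, so only \<open>(n - 2) f\<^sub>n = 0\<close> remains, where
  \<open>n \<noteq> 2\<close>.\<close>

lemma qderiv_linear_even:
  assumes "qderiv f = g * f" "fps_nth g 0 = 2" "\<And>k. odd k \<Longrightarrow> fps_nth g k = 0" "odd n"
  shows "fps_nth f n = 0"
  using \<open>odd n\<close>
proof (induction n rule: less_induct)
  case (less n)
  have "real n * fps_nth f n = (\<Sum>i=0..n. fps_nth g i * fps_nth f (n - i))"
    using arg_cong[OF assms(1), of "\<lambda>h. fps_nth h n"] by (simp add: fps_mult_nth)
  also have "\<dots> = (\<Sum>i\<in>{0}. fps_nth g i * fps_nth f (n - i))"
  proof (rule sum.mono_neutral_right)
    show "\<forall>i\<in>{0..n} - {0}. fps_nth g i * fps_nth f (n - i) = 0"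
    proof
      fix i assume "i \<in> {0..n} - {0}"
      then show "fps_nth g i * fps_nth f (n - i) = 0"
        using less assms(3)[of i] by (cases "odd i") auto
    qed
  qed auto
  finally have "(real n - 2) * fps_nth f n = 0"
    using assms(2) by (simp add: algebra_simps)
  moreover have "real n \<noteq> 2"
    using less.prems by auto
  ultimately show ?case
    by simp
qed

lemma twisted_sigma_series_0 [simp]: "fps_nth (twisted_sigma_series \<epsilon> r) 0 = 0"
  by (simp add: twisted_sigma_series_def divisor_series_def)

lemma twisted_sigma_series_1: "fps_nth (twisted_sigma_series \<epsilon> r) (Suc 0) = \<epsilon>"
  by (simp add: twisted_sigma_series_def divisor_series_def)

lemma tau_series_discriminant:
  "64 * tau_series = dagger_eisenstein4 ^ 2 * (level_two_eisenstein2 ^ 2 - dagger_eisenstein4)"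
    (is "_ = ?D")
proof -
  have "64 * tau_series - ?D = 0"
  proof (rule qderiv_linear_unique)
    have "qderiv (64 * tau_series - ?D) = 64 * qderiv tau_series - qderiv ?D"
      by simp
    then show "qderiv (64 * tau_series - ?D) = eisenstein2 * (64 * tau_series - ?D)"
      using qderiv_discriminant qderiv_tau_series by algebra
    show "fps_nth eisenstein2 0 = 1"
      by (simp add: eisenstein2_def)
    \<comment> \<open>Since \<open>e = 1 + 24 q + ...\<close> and \<open>Q = 1 - 16 q + ...\<close>,
      the series \<open>e^2 - Q\<close> starts with \<open>64 q\<close>.\<close>
    show "fps_nth (64 * tau_series - ?D) 1 = 0"
      by (simp add: tau_series_eq eta24_0 fps_mult_nth power2_eq_square numeral_fps_const
          dagger_eisenstein4_def level_two_eisenstein2_def eisenstein2_def dilate_nth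
          twisted_sigma_series_1)
  qed
  then show ?thesis
    by simp
qed

section \<open>Coefficients at odd indices\<close>

lemma dagger_series_nth: "fps_nth (dagger_series r) n = real_of_int (divisor_sigma_dagger r n)"
  by (simp add: twisted_sigma_series_def divisor_series_def divisor_sigma_dagger_def)

lemma dagger_series_nth_odd:
  assumes "odd n"
  shows "fps_nth (dagger_series r) n = - real (divisor_sigma r n)"
proof -
  have "fps_nth (dagger_series r) n = (\<Sum>d | d dvd n. - real (d ^ r))"
    unfolding twisted_sigma_series_def divisor_series_def fps_nth_Abs_fps
    by (rule sum.cong) (use assms dvd_trans in \<open>auto simp: minus_one_power_iff\<close>)
  then show ?thesis
    by (simp add: divisor_sigma_def sum_negf)
qed

lemma dagger_eisenstein4_cube_nth_odd:
  assumes "odd n"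
  shows "691 * fps_nth (dagger_eisenstein4 ^ 3) n =
    - 16 * (real (divisor_sigma 11 n) + 2072 * real_of_int (ramanujan_tau n))"
proof -
  let ?Q = dagger_eisenstein4 and ?e = level_two_eisenstein2
  let ?E = "?Q * (?e ^ 2 - ?Q) ^ 2"
  \<comment> \<open>Substitute \<open>e^2 = Q + \<delta>\<close> in the weight 12 relation: the
    coefficients of \<open>Q^3\<close>, \<open>Q^2 \<delta>\<close> and \<open>Q \<delta>^2\<close>
    become 691, 518 and 16, and \<open>518 * 64 = 33152\<close>.\<close>
  have "691 * ?Q ^ 3 = 691 + 16 * dagger_series 11 - 33152 * tau_series - 16 * ?E"
    using dagger_eisenstein12_eq tau_series_discriminant by algebra
  moreover have "fps_nth ?E n = 0"
  proof (rule qderiv_linear_even[OF qderiv_dilate_discriminant _ _ assms])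
    show "fps_nth (2 * dilate eisenstein2) 0 = 2"
      by (simp add: dilate_nth eisenstein2_def)
    show "fps_nth (2 * dilate eisenstein2) k = 0" if "odd k" for k
      using that by (simp add: dilate_nth numeral_fps_const)
  qed
  ultimately have "fps_nth (691 * ?Q ^ 3) n =
      16 * fps_nth (dagger_series 11) n - 33152 * fps_nth tau_series n"
    using assms by (cases n) (simp_all add: numeral_fps_const)
  then show ?thesis
    using assms by (simp add: dagger_series_nth_odd tau_series_def numeral_fps_const)
qed

lemma dagger_convolution_nth_odd:
  assumes "odd n"
  shows "512 * fps_nth (dagger_series 3 * dagger_series 7 - dagger_series 5 ^ 2) n =
    9 * fps_nth (dagger_eisenstein4 ^ 3) n + 272 * real (divisor_sigma 3 n) +
    128 * real (divisor_sigma 5 n) + 32 * real (divisor_sigma 7 n)"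
proof -
  let ?Q = dagger_eisenstein4
  \<comment> \<open>The factor \<open>512 = 16 * 32 = 8 * 8^2\<close> clears all denominators. The
    terms \<open>8 e^2 Q^2\<close> cancel, and what remains besides \<open>9 Q^3\<close> is linear
    in the dagger series.\<close>
  have "512 * (dagger_series 3 * dagger_series 7 - dagger_series 5 ^ 2) =
      9 * ?Q ^ 3 - 9 - 272 * dagger_series 3 - 128 * dagger_series 5 - 32 * dagger_series 7"
    using dagger_eisenstein8_eq dagger_eisenstein6_factor unfolding dagger_eisenstein4_def
    by algebra
  then have "fps_nth (512 * (dagger_series 3 * dagger_series 7 - dagger_series 5 ^ 2)) n =
      9 * fps_nth (?Q ^ 3) n - 272 * fps_nth (dagger_series 3) n -
      128 * fps_nth (dagger_series 5) n - 32 * fps_nth (dagger_series 7) n"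
    using assms by (cases n) (simp_all add: numeral_fps_const)
  then show ?thesis
    using assms by (simp add: dagger_series_nth_odd numeral_fps_const)
qed

theorem theorem1p8:
  fixes n :: nat
  assumes "n > 0" and "odd n"
  shows "259 * real_of_int (ramanujan_tau n) =
    1 / (2 ^ 3 * 3 ^ 2) *
      (17 * 691 * real (divisor_sigma 3 n) + 8 * 691 * real (divisor_sigma 5 n)
        + 2 * 691 * real (divisor_sigma 7 n) - 9 * real (divisor_sigma 11 n))
    - 691 * 2 ^ 2 / 3 ^ 2 *
      (\<Sum>m = 1..n - 1. real_of_int
        (divisor_sigma_dagger 3 m * divisor_sigma_dagger 7 (n - m)
          - divisor_sigma_dagger 5 m * divisor_sigma_dagger 5 (n - m)))"
proof -
  let ?S = "\<Sum>m = 1..n - 1. real_of_int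
        (divisor_sigma_dagger 3 m * divisor_sigma_dagger 7 (n - m)
          - divisor_sigma_dagger 5 m * divisor_sigma_dagger 5 (n - m))"
  \<comment> \<open>The sum over the infinite set of divisors of 0 is 0 by default, so the Cauchy
    product loses its terms \<open>m = 0\<close> and \<open>m = n\<close>.\<close>
  have zero: "divisor_sigma_dagger r 0 = 0" for r
    by (simp add: divisor_sigma_dagger_def)
  have "fps_nth (dagger_series 3 * dagger_series 7 - dagger_series 5 ^ 2) n =
      (\<Sum>m=0..n. real_of_int (divisor_sigma_dagger 3 m * divisor_sigma_dagger 7 (n - m)
          - divisor_sigma_dagger 5 m * divisor_sigma_dagger 5 (n - m)))"
    by (simp add: power2_eq_square fps_mult_nth dagger_series_nth sum_subtractf)
  also have "\<dots> = ?S"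
    by (rule sum.mono_neutral_right) (use zero in \<open>auto simp: not_le\<close>)
  \<comment> \<open>Eliminate the coefficient of \<open>Q^3\<close> and divide by
    \<open>1152 = 16 * 72\<close>; here \<open>9 * 16 * 2072 = 1152 * 259\<close>.\<close>
  finally show ?thesis
    using dagger_convolution_nth_odd[OF assms(2)] dagger_eisenstein4_cube_nth_odd[OF assms(2)]
    by (simp add: field_simps)
qed

end
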